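(* Let $B_1,B_2\in\mathcal K_c$. Then exactly one of the following three happens: (a) $\mathbf h(B_1)\preceq\mathbf h(B_2)$, $\mathbf h(B_1)\ne\mathbf h(B_2)$, and $\mathbb P(B_1\preceq B_2\text{ and }B_1\ne B_2)=1$; (b) $\mathbf h(B_2)\preceq\mathbf h(B_1)$, $\mathbf h(B_2)\ne\mathbf h(B_1)$, and $\mathbb P(B_2\preceq B_1\text{ and }B_2\ne B_1)=1$; (c) $\mathbf h(B_1)=\mathbf h(B_2)$ and $\mathbb P(B_1=B_2)=1$.
   Context: $\Omega=\mathbb R^{\mathbb Z^2}$ with its Borel $\sigma$-algebra $\mathcal F$, generic element $\omega=(\omega_x)_{x\in\mathbb Z^2}$, shifts $(T_z\omega)_x=\omega_{x+z}$. $\mathbb P$ is a product probability measure on $\Omega$ under which the $\omega_x$ are i.i.d. with $\mathbb E[|\omega_0|^{2+\epsilon}]<\infty$ for some $\epsilon>0$ and $\mathbb E[\omega_0^2]>\mathbb E[\omega_0]^2$. $e_1=(1,0)$, $e_2=(0,1)$. A function $b:\mathbb Z^2\times\mathbb Z^2\to\mathbb R$ is a cocycle if $b(x,y)+b(y,z)=b(x,z)$ for all $x,y,z$; it recovers the weights $\omega$ if $\min\{b(x,x+e_1),b(x,x+e_2)\}=\omega_x$ for all $x$. $\mathcal K$ is the collection of measurable functions $B:\Omega\times\mathbb Z^2\times\mathbb Z^2\to\mathbb R$ such that: $\mathbb P$-a.s. $B(\omega,\cdot,\cdot)$ is a cocycle recovering $\omega$; $\mathbb P$-a.s. $B(\omega,x+z,y+z)=B(T_z\omega,x,y)$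 for all $x,y,z$; and $\mathbb E[|B(x,y)|]<\infty$ for all $x,y$. For $B\in\mathcal K$, $\mathbf h(B)\in\mathbb R^2$ is the deterministic vector with $\mathbf h(B)\cdot e_i=-\mathbb E[B(0,e_i)]$, $i\in\{1,2\}$. For $u\in\mathbb Z^2$ let $x^{B,u}(\omega)$ be the semi-infinite path started at $u$ which from each visited site $x$ steps to $x+e_1$ if $B(\omega,x,x+e_1)\le B(\omega,x,x+e_2)$ and to $x+e_2$ otherwise. Up-right paths are indexed by antidiagonal level, $\pi_i\cdot(e_1+e_2)=i$; two semi-infinite up-right paths coalesce if they agree at all sufficiently large levels. $\mathcal K_c\subset\mathcal K$ is the set of those $B$ for which, $\mathbb P$-a.s., $x^{B,u}$ and $x^{B,v}$ coalesce for all $u,v\in\mathbb Z^2$. Orders. For $h,h'\in\mathbb R^2$, $h\preceq h'$ means $h\cdot e_1\le h'\cdot e_1$ and $h\cdot e_2\ge h'\cdot e_2$. For cocycles, $b\preceq b'$ means $b(x,x+e_1)\ge b'(x,x+e_1)$ and $b(x,x+e_2)\le b'(x,x+e_2)$ for all $x\in\mathbb Z^2$. *)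

theory Defs
  imports "HOL-Probability.Probability"
begin

type_synonym site = "int \<times> int"
type_synonym config = "site \<Rightarrow> real"

definition e1 :: site where "e1 = (1, 0)"
definition e2 :: site where "e2 = (0, 1)"

definition shift :: "site \<Rightarrow> config \<Rightarrow> config" where
  "shift z \<omega> = (\<lambda>x. \<omega> (x + z))"

definition iid_measure :: "real measure \<Rightarrow> config measure" where
  "iid_measure \<nu> = PiM UNIV (\<lambda>_. \<nu>)"

lemma sets_iid_measure:
  assumes "sets \<nu> = sets borel"
  shows "sets (iid_measure \<nu>) = sets borel"
  unfolding iid_measure_def
  by (subst sets_PiM_cong[OF refl, of UNIV _ "\<lambda>_. borel"]) (auto simp: assms sets_PiM_equal_borel)

definition cocycle :: "(site \<Rightarrow> site \<Rightarrow> real) \<Rightarrow> bool" where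
  "cocycle b \<longleftrightarrow> (\<forall>x y z. b x y + b y z = b x z)"

definition recovers :: "(site \<Rightarrow> site \<Rightarrow> real) \<Rightarrow> config \<Rightarrow> bool" where
  "recovers b \<omega> \<longleftrightarrow> (\<forall>x. min (b x (x + e1)) (b x (x + e2)) = \<omega> x)"

definition cocycles :: "config measure \<Rightarrow> (config \<Rightarrow> site \<Rightarrow> site \<Rightarrow> real) set" where
  "cocycles P = {B.
     (\<lambda>(\<omega>, x, y). B \<omega> x y) \<in>
       borel_measurable (P \<Otimes>\<^sub>M (count_space UNIV \<Otimes>\<^sub>M count_space UNIV)) \<and>
     (AE \<omega> in P. cocycle (B \<omega>) \<and> recovers (B \<omega>) \<omega>) \<and>
     (AE \<omega> in P. \<forall>x y z. B \<omega> (x + z) (y + z) = B (shift z \<omega>) x y) \<and>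
     (\<forall>x y. integrable P (\<lambda>\<omega>. B \<omega> x y))}"

definition h_vec :: "config measure \<Rightarrow> (config \<Rightarrow> site \<Rightarrow> site \<Rightarrow> real) \<Rightarrow> real \<times> real" where
  "h_vec P B = (- (\<integral>\<omega>. B \<omega> 0 e1 \<partial>P), - (\<integral>\<omega>. B \<omega> 0 e2 \<partial>P))"

definition next_site :: "(site \<Rightarrow> site \<Rightarrow> real) \<Rightarrow> site \<Rightarrow> site" where
  "next_site b x = (if b x (x + e1) \<le> b x (x + e2) then x + e1 else x + e2)"

definition level :: "site \<Rightarrow> int" where
  "level x = fst x + snd x"

text \<open>The path from \<open>u\<close> is indexed by antidiagonal level; it lives on the levels
  \<open>i \<ge> level u\<close>, and its value at lower levels is the irrelevant value \<open>u\<close>.\<close>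

definition cocycle_path :: "(site \<Rightarrow> site \<Rightarrow> real) \<Rightarrow> site \<Rightarrow> int \<Rightarrow> site" where
  "cocycle_path b u i = (next_site b ^^ nat (i - level u)) u"

lemma level_cocycle_path:
  assumes "level u \<le> i"
  shows "level (cocycle_path b u i) = i"
proof -
  have "level ((next_site b ^^ n) u) = level u + int n" for n
    by (induction n) (auto simp: next_site_def level_def e1_def e2_def)
  then show ?thesis
    using assms by (simp add: cocycle_path_def)
qed

definition coalesce :: "(int \<Rightarrow> site) \<Rightarrow> (int \<Rightarrow> site) \<Rightarrow> bool" where
  "coalesce \<pi> \<pi>' \<longleftrightarrow> (\<forall>\<^sub>F i in at_top. \<pi> i = \<pi>' i)"

definition coalescing_cocycles :: "config measure \<Rightarrow> (config \<Rightarrow> site \<Rightarrow> site \<Rightarrow> real) set" where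
  "coalescing_cocycles P = {B \<in> cocycles P.
     AE \<omega> in P. \<forall>u v. coalesce (cocycle_path (B \<omega>) u) (cocycle_path (B \<omega>) v)}"

definition vec_le :: "real \<times> real \<Rightarrow> real \<times> real \<Rightarrow> bool" where
  "vec_le h h' \<longleftrightarrow> fst h \<le> fst h' \<and> snd h \<ge> snd h'"

definition cocycle_le :: "(site \<Rightarrow> site \<Rightarrow> real) \<Rightarrow> (site \<Rightarrow> site \<Rightarrow> real) \<Rightarrow> bool" where
  "cocycle_le b b' \<longleftrightarrow>
     (\<forall>x. b x (x + e1) \<ge> b' x (x + e1) \<and> b x (x + e2) \<le> b' x (x + e2))"

definition exactly_one :: "bool \<Rightarrow> bool \<Rightarrow> bool \<Rightarrow> bool" where
  "exactly_one p q r \<longleftrightarrow> (p \<or> q \<or> r) \<and> \<not> (p \<and> q) \<and> \<not> (p \<and> r) \<and> \<not> (q \<and> r)"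

end

theory Submission
  imports Defs
begin

text \<open>
  The argument combines a deterministic comparison of cocycles that recover the same weights with
  the ergodicity of \<open>P\<close> under shifts.

  \<^emph>\<open>Comparison.\<close> Let \<open>b\<close> and \<open>b'\<close> be cocycles recovering the same weights. Along a \<open>b\<close>-path the
  increments of \<open>b\<close> equal the weights, while those of \<open>b'\<close> are at least the weights. So if the
  \<open>b\<close>-path from \<open>u\<close> and the \<open>b'\<close>-path from \<open>v\<close> meet at \<open>p\<close>, then
  \<open>b u v = b u p - b v p \<le> b' u p - b' v p = b' u v\<close> (\<open>le_if_paths_meet\<close>). Now suppose that all
  \<open>b\<close>-paths coalesce and all \<open>b'\<close>-paths coalesce. If the two paths from the origin meet infinitely
  often, then every \<open>b\<close>-path meets every \<open>b'\<close>-path, and \<open>b = b'\<close>. Otherwise, by planarity, one of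
  them, say the \<open>b\<close>-path, is eventually strictly to the right of the other, and by coalescence the
  same holds for any two starting points. The \<open>b\<close>-path from \<open>x\<close> must then cross the \<open>b'\<close>-path from
  \<open>x + e1\<close>, and the \<open>b\<close>-path from \<open>x + e2\<close> must cross the \<open>b'\<close>-path from \<open>x\<close>; the two resulting
  inequalities say that \<open>cocycle_le b' b\<close>. Hence any two such cocycles are comparable
  (\<open>coalescing_cocycles_comparable\<close>).

  \<^emph>\<open>Ergodicity.\<close> By shift covariance, each of the events \<open>cocycle_le (B1 \<omega>) (B2 \<omega>)\<close>,
  \<open>cocycle_le (B2 \<omega>) (B1 \<omega>)\<close> and \<open>B1 \<omega> = B2 \<omega>\<close> is shift-invariant up to a null set, so it has
  probability 0 or 1 (\<open>zero_one_law_reindex\<close>), and one of the first two has probability 1.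
  Taking expectations orders the vectors \<open>h_vec\<close>. If these vectors coincide, then the ordered
  nearest-neighbour increments have equal means, hence agree almost surely, and the cocycles are
  equal; if they differ, then \<open>B1 = B2\<close> does not have probability 1, so it has probability 0.
\<close>

section \<open>A zero-one law for invariant events of product measures\<close>

text \<open>The class of events that are asymptotically independent of a given sequence \<open>D\<close> is a Dynkin
  system, so it suffices to test it on an intersection-stable generator.\<close>

lemma (in prob_space) asymptotically_independent_from_generator:
  assumes G: "Int_stable G" "G \<subseteq> Pow (space M)" "events = sigma_sets (space M) G"
    and D: "\<And>n. D n \<in> events" "(\<lambda>n. prob (D n)) \<longlonglongrightarrow> c"
    and generator: "\<And>C. C \<in> G \<Longrightarrow> (\<lambda>n. prob (C \<inter> D n)) \<longlonglongrightarrow> prob C * c"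
    and A: "A \<in> events"
  shows "(\<lambda>n. prob (A \<inter> D n)) \<longlonglongrightarrow> prob A * c"
  using G(1,2) A[unfolded G(3)]
proof (induction rule: sigma_sets_induct_disjoint)
  case (basic A)
  then show ?case by (rule generator)
next
  case empty
  show ?case by simp
next
  case (compl A)
  then have A: "A \<in> events" by (simp add: G(3))
  have "prob ((space M - A) \<inter> D n) = prob (D n) - prob (A \<inter> D n)" for n
  proof -
    have "(space M - A) \<inter> D n = D n - A \<inter> D n"
      using sets.sets_into_space[OF D(1)[of n]] by auto
    then show ?thesis
      using A D(1)[of n] by (simp add: finite_measure_Diff)
  qed
  moreover have "prob (space M - A) * c = c - prob A * c"
    using A by (simp add: prob_compl algebra_simps)
  ultimately show ?case
    using tendsto_diff[OF D(2) compl(2)] by simp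
next
  case (union A)
  then have A: "range A \<subseteq> events" by (simp add: G(3))
  have sums: "(\<lambda>k. prob (A k)) sums prob (\<Union>k. A k)"
    by (rule finite_measure_UNION[OF A union(1)])
  have eq: "prob ((\<Union>k. A k) \<inter> D n) = (\<Sum>k. prob (A k \<inter> D n))" for n
  proof -
    have "(\<lambda>k. prob (A k \<inter> D n)) sums prob (\<Union>k. A k \<inter> D n)"
      using A D(1)[of n] union(1)
      by (intro finite_measure_UNION) (auto simp: disjoint_family_on_def)
    then show ?thesis by (simp add: sums_iff)
  qed
  have "norm (prob (A k \<inter> D n)) \<le> prob (A k)" for k n
    using A by (auto intro!: finite_measure_mono)
  then have "(\<lambda>n. \<Sum>k. prob (A k \<inter> D n)) \<longlonglongrightarrow> (\<Sum>k. prob (A k) * c)"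
    using union(3) sums
    by (intro tannerys_theorem[where M = "\<lambda>k. prob (A k)", THEN conjunct2, THEN conjunct2])
      (auto simp: sums_iff simp: case_prod_unfold)
  moreover have "(\<Sum>k. prob (A k) * c) = prob (\<Union>k. A k) * c"
    using sums by (simp add: sums_iff flip: suminf_mult2)
  ultimately show ?case by (simp add: eq)
qed

lemma distr_PiM_comp:
  assumes "prob_space N" "inj f"
  shows "distr (PiM UNIV (\<lambda>_. N)) (PiM UNIV (\<lambda>_. N)) (\<lambda>\<omega>. \<omega> \<circ> f) = PiM UNIV (\<lambda>_. N)"
  using distr_PiM_reindex[of UNIV "\<lambda>_. N" f UNIV] assms by (simp add: comp_def restrict_UNIV)

lemma measurable_PiM_comp [measurable]:
  "(\<lambda>\<omega>. \<omega> \<circ> f) \<in> PiM UNIV (\<lambda>_. N) \<rightarrow>\<^sub>M PiM UNIV (\<lambda>_. N)"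
  by (rule measurable_PiM_single') (auto simp: space_PiM comp_def)

text \<open>The maps \<open>f n\<close> move every coordinate out of every finite window. Hence, for a cylinder \<open>C'\<close>,
  the preimages of \<open>C'\<close> under \<open>\<omega> \<mapsto> \<omega> \<circ> f n\<close> are asymptotically independent of every event \<open>A\<close>. If
  \<open>A\<close> is invariant, \<open>A\<close> is therefore independent of \<open>C'\<close>, and so, cylinders being a generator, of
  itself.\<close>

theorem zero_one_law_reindex:
  fixes N :: "'a measure" and f :: "nat \<Rightarrow> 'i \<Rightarrow> 'i"
  defines "Q \<equiv> PiM UNIV (\<lambda>_. N)"
  assumes N: "prob_space N" and inj: "\<And>n. inj (f n)"
    and escape: "\<And>i j. \<forall>\<^sub>F n in sequentially. f n i \<noteq> j"
    and A: "A \<in> sets Q" and inv: "\<And>n. AE \<omega> in Q. \<omega> \<circ> f n \<in> A \<longleftrightarrow> \<omega> \<in> A"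
  shows "measure Q A = 0 \<or> measure Q A = 1"
proof -
  interpret N: prob_space N by fact
  interpret product_prob_space "\<lambda>_. N" "UNIV :: 'i set" ..
  interpret Q: prob_space Q unfolding Q_def by (rule prob_space_PiM) (rule N)
  define G where "G = prod_algebra (UNIV :: 'i set) (\<lambda>_. N)"
  have space_Q: "space Q = (\<Pi>\<^sub>E i\<in>UNIV. space N)"
    by (simp add: Q_def space_PiM)
  have G: "Int_stable G" "G \<subseteq> Pow (space Q)" "sets Q = sigma_sets (space Q) G"
    unfolding space_Q by (auto simp: Q_def G_def sets_PiM Int_stable_prod_algebra
        dest: set_mp[OF prod_algebra_sets_into_space])
  have G_sets: "C \<in> sets Q" if "C \<in> G" for C
    using that G(3) by auto
  define T where "T n C = (\<lambda>\<omega>. \<omega> \<circ> f n) -` C \<inter> space Q" for n C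
  have T_meas: "T n C \<in> sets Q" if "C \<in> sets Q" for n C
    unfolding T_def using that by (auto simp: Q_def intro!: measurable_sets[OF measurable_PiM_comp])
  have T_prob: "Q.prob (T n C) = Q.prob C" if "C \<in> sets Q" for n C
    using measure_distr[of "\<lambda>\<omega>. \<omega> \<circ> f n" Q Q C] that distr_PiM_comp[OF N inj, of n]
    by (simp add: Q_def T_def)
  have cylinders: "(\<lambda>n. Q.prob (C \<inter> T n C')) \<longlonglongrightarrow> Q.prob C * Q.prob C'"
    if C: "C \<in> G" and C': "C' \<in> G" for C C'
  proof -
    from C obtain J E where J: "C = prod_emb UNIV (\<lambda>_. N) J (\<Pi>\<^sub>E j\<in>J. E j)" "finite J"
      "\<And>i. i \<in> J \<Longrightarrow> E i \<in> sets N"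
      unfolding G_def by (elim prod_algebraE) blast
    from C' obtain K F where K: "C' = prod_emb UNIV (\<lambda>_. N) K (\<Pi>\<^sub>E j\<in>K. F j)" "finite K"
      "\<And>i. i \<in> K \<Longrightarrow> F i \<in> sets N"
      unfolding G_def by (elim prod_algebraE) blast
    have "\<forall>\<^sub>F n in sequentially. \<forall>i\<in>K. \<forall>j\<in>J. f n i \<noteq> j"
      using J(2) K(2) escape by (simp add: eventually_ball_finite_distrib)
    then have "\<forall>\<^sub>F n in sequentially. Q.prob (C \<inter> T n C') = Q.prob C * Q.prob C'"
    proof eventually_elim
      case (elim n)
      \<comment> \<open>The windows \<open>J\<close> and \<open>f n ` K\<close> are disjoint, so the intersection is a cylinder over their
        union, with sides \<open>H\<close>.\<close>
      define H where "H i = (if i \<in> J then E i else F (inv (f n) i))" for i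
      have HK: "H (f n i) = F i" if "i \<in> K" for i
        using elim that inj[of n] by (auto simp: H_def)
      have HJ: "H j = E j" if "j \<in> J" for j
        using that by (simp add: H_def)
      have disj: "J \<inter> f n ` K = {}"
        using elim by blast
      have "C \<inter> T n C' = prod_emb UNIV (\<lambda>_. N) (J \<union> f n ` K) (\<Pi>\<^sub>E j\<in>J \<union> f n ` K. H j)"
        (is "_ = ?R")
      proof (intro set_eqI)
        fix \<omega>
        have "\<omega> \<in> C \<inter> T n C' \<longleftrightarrow>
            \<omega> \<in> space Q \<and> (\<forall>j\<in>J. \<omega> j \<in> E j) \<and> (\<forall>i\<in>K. \<omega> (f n i) \<in> F i)"
          by (auto simp: J(1) K(1) T_def prod_emb_iff space_Q PiE_iff)
        also have "\<dots> \<longleftrightarrow> \<omega> \<in> space Q \<and> (\<forall>j\<in>J \<union> f n ` K. \<omega> j \<in> H j)"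
          by (simp add: ball_Un HJ HK)
        also have "\<dots> \<longleftrightarrow> \<omega> \<in> ?R"
          by (auto simp: prod_emb_iff space_Q PiE_iff)
        finally show "\<omega> \<in> C \<inter> T n C' \<longleftrightarrow> \<omega> \<in> ?R" .
      qed
      moreover have "H i \<in> sets N" if "i \<in> J \<union> f n ` K" for i
        using that J(3) K(3) HJ HK by auto
      ultimately have "Q.prob (C \<inter> T n C') = (\<Prod>i\<in>J \<union> f n ` K. N.prob (H i))"
        unfolding Q_def using J(2) K(2) measure_PiM_emb[of "J \<union> f n ` K" H] by simp
      also have "\<dots> = (\<Prod>i\<in>J. N.prob (H i)) * (\<Prod>i\<in>f n ` K. N.prob (H i))"
        using J(2) K(2) disj by (intro prod.union_disjoint) auto
      also have "(\<Prod>i\<in>f n ` K. N.prob (H i)) = (\<Prod>i\<in>K. N.prob (F i))"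
        using HK inj_on_subset[OF inj subset_UNIV] by (simp add: prod.reindex)
      also have "(\<Prod>i\<in>J. N.prob (H i)) = (\<Prod>i\<in>J. N.prob (E i))"
        by (simp add: HJ)
      finally show ?case
        unfolding Q_def using J K by (simp add: measure_PiM_emb)
    qed
    then show ?thesis by (rule tendsto_eventually)
  qed
  have indep: "Q.prob (A \<inter> C) = Q.prob A * Q.prob C" if C: "C \<in> G" for C
  proof -
    have "(\<lambda>n. Q.prob (A \<inter> T n C)) \<longlonglongrightarrow> Q.prob A * Q.prob C"
      by (rule Q.asymptotically_independent_from_generator[OF G])
        (use C A cylinders in \<open>auto simp: T_meas T_prob G_sets\<close>)
    \<comment> \<open>By invariance \<open>A\<close> may be replaced by \<open>T n A\<close>, so the sequence is constant.\<close>
    moreover have "Q.prob (A \<inter> T n C) = Q.prob (A \<inter> C)" for n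
    proof -
      have AC: "A \<inter> C \<in> sets Q"
        using A G_sets[OF C] by (rule sets.Int)
      have "Q.prob (A \<inter> T n C) = Q.prob (T n (A \<inter> C))"
      proof (rule Q.finite_measure_eq_AE)
        show "AE \<omega> in Q. \<omega> \<in> A \<inter> T n C \<longleftrightarrow> \<omega> \<in> T n (A \<inter> C)"
          using inv[of n] by eventually_elim (auto simp: T_def)
      qed (intro sets.Int T_meas A G_sets C AC)+
      then show ?thesis
        by (simp add: T_prob AC)
    qed
    ultimately show ?thesis
      by (simp add: LIMSEQ_const_iff)
  qed
  have "(\<lambda>n::nat. Q.prob (A \<inter> A)) \<longlonglongrightarrow> Q.prob A * Q.prob A"
  proof (rule Q.asymptotically_independent_from_generator[OF G])
    fix C
    assume "C \<in> G"
    then show "(\<lambda>n::nat. Q.prob (C \<inter> A)) \<longlonglongrightarrow> Q.prob C * Q.prob A"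
      using indep[of C] by (simp add: Int_commute mult.commute)
  qed (simp_all add: A)
  then show ?thesis
    by (simp add: LIMSEQ_const_iff)
qed

section \<open>Comparison of cocycles with coalescing paths\<close>

lemma le_along_iterates:
  assumes "cocycle b" "cocycle b'" "recovers b \<omega>" "recovers b' \<omega>"
  shows "b u ((next_site b ^^ n) u) \<le> b' u ((next_site b ^^ n) u)"
proof (induction n)
  case 0
  have "b u u + b u u = b u u" "b' u u + b' u u = b' u u"
    using assms by (simp_all only: cocycle_def)
  then show ?case by simp
next
  case (Suc n)
  let ?x = "(next_site b ^^ n) u"
  have "b ?x (next_site b ?x) = \<omega> ?x" "\<omega> ?x \<le> b' ?x (next_site b ?x)"
    using assms(3,4)[unfolded recovers_def, rule_format, of ?x]
    by (auto simp: next_site_def min_def split: if_splits)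
  moreover have "b u ?x + b ?x (next_site b ?x) = b u (next_site b ?x)"
    "b' u ?x + b' ?x (next_site b ?x) = b' u (next_site b ?x)"
    using assms(1,2) by (simp_all only: cocycle_def)
  ultimately show ?case
    using Suc by simp
qed

lemma le_if_paths_meet:
  assumes "cocycle b" "cocycle b'" "recovers b \<omega>" "recovers b' \<omega>"
    and meet: "cocycle_path b u i = cocycle_path b' v j"
  shows "b u v \<le> b' u v"
proof -
  let ?p = "cocycle_path b u i"
  have "b u ?p \<le> b' u ?p"
    unfolding cocycle_path_def by (rule le_along_iterates) fact+
  moreover have "b' v ?p \<le> b v ?p"
    unfolding meet unfolding cocycle_path_def by (rule le_along_iterates) fact+
  moreover have "b u v + b v ?p = b u ?p" "b' u v + b' v ?p = b' u ?p"
    using assms(1,2) by (simp_all only: cocycle_def)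
  ultimately show ?thesis by simp
qed

lemma cocycle_path_step:
  assumes "level u \<le> i"
  shows "cocycle_path b u (i + 1) = next_site b (cocycle_path b u i)"
proof -
  have "nat (i + 1 - level u) = Suc (nat (i - level u))"
    using assms by simp
  then show ?thesis by (simp add: cocycle_path_def)
qed

text \<open>Planarity: on an antidiagonal, a site is determined by its first coordinate, and the
  difference of the first coordinates of two paths changes by at most one per step. So paths that
  change sides meet.\<close>

lemma paths_meet:
  assumes "level u \<le> k" "level v \<le> k" "k \<le> m"
    and start: "fst (cocycle_path b u k) \<le> fst (cocycle_path b' v k)"
    and stop: "fst (cocycle_path b' v m) \<le> fst (cocycle_path b u m)"
  shows "\<exists>i\<ge>k. cocycle_path b u i = cocycle_path b' v i"
proof -
  define d where "d n = fst (cocycle_path b u (k + int n)) - fst (cocycle_path b' v (k + int n))" for n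
  have "\<bar>d (n + 1) - d n\<bar> \<le> 1" for n
  proof -
    have step: "fst x \<le> fst (next_site c x)" "fst (next_site c x) \<le> fst x + 1" for c x
      by (simp_all add: next_site_def e1_def e2_def)
    have k: "k + int (n + 1) = (k + int n) + 1" by simp
    have path: "cocycle_path b u (k + int (n + 1)) = next_site b (cocycle_path b u (k + int n))"
      "cocycle_path b' v (k + int (n + 1)) = next_site b' (cocycle_path b' v (k + int n))"
      unfolding k by (rule cocycle_path_step, use assms(1,2) in simp)+
    show ?thesis
      using step[where x = "cocycle_path b u (k + int n)" and c = b]
        step[where x = "cocycle_path b' v (k + int n)" and c = b']
      unfolding d_def path by linarith
  qed
  moreover have "d 0 \<le> 0" "0 \<le> d (nat (m - k))"
    using assms by (auto simp: d_def)
  ultimately obtain n where "d n = 0"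
    using nat0_intermed_int_val[of "nat (m - k)" d 0] by auto
  moreover have "level (cocycle_path b u (k + int n)) = level (cocycle_path b' v (k + int n))"
    using assms(1,2) by (simp add: level_cocycle_path)
  ultimately have "cocycle_path b u (k + int n) = cocycle_path b' v (k + int n)"
    by (simp add: d_def level_def prod_eq_iff)
  then show ?thesis
    by (intro exI[of _ "k + int n"]) simp
qed

lemma cocycles_eq_if_paths_meet_frequently:
  assumes "cocycle b" "cocycle b'" "recovers b \<omega>" "recovers b' \<omega>"
    and coal: "\<And>u v. coalesce (cocycle_path b u) (cocycle_path b v)"
      "\<And>u v. coalesce (cocycle_path b' u) (cocycle_path b' v)"
    and freq: "\<exists>\<^sub>F i in at_top. cocycle_path b 0 i = cocycle_path b' 0 i"
  shows "b = b'"
proof (intro ext antisym)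
  fix u v
  have meet: "\<exists>i. cocycle_path b u i = cocycle_path b' v i" for u v
  proof -
    have "\<forall>\<^sub>F i in at_top. cocycle_path b u i = cocycle_path b 0 i \<and>
        cocycle_path b' v i = cocycle_path b' 0 i"
      using coal(1)[of u 0] coal(2)[of v 0] by (auto simp: coalesce_def eventually_conj_iff)
    from frequently_ex[OF frequently_eventually_conj[OF freq this]] show ?thesis
      by metis
  qed
  show "b u v \<le> b' u v"
    using meet[of u v] le_if_paths_meet[OF assms(1-4)] by blast
  show "b' u v \<le> b u v"
    using meet[of v u] le_if_paths_meet[OF assms(2,1,4,3)] by metis
qed

lemma cocycle_le_if_path_eventually_right:
  assumes "cocycle b" "cocycle b'" "recovers b \<omega>" "recovers b' \<omega>"
    and coal: "\<And>u v. coalesce (cocycle_path b u) (cocycle_path b v)"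
      "\<And>u v. coalesce (cocycle_path b' u) (cocycle_path b' v)"
    and right: "\<forall>\<^sub>F i in at_top. fst (cocycle_path b' 0 i) \<le> fst (cocycle_path b 0 i)"
  shows "cocycle_le b' b"
  unfolding cocycle_le_def
proof (intro allI conjI)
  fix x
  have right_all: "\<exists>m\<ge>k. fst (cocycle_path b' v m) \<le> fst (cocycle_path b u m)" for u v k
  proof -
    have "\<forall>\<^sub>F i in at_top. fst (cocycle_path b' v i) \<le> fst (cocycle_path b u i)"
      using coal(1)[of u 0, unfolded coalesce_def] coal(2)[of v 0, unfolded coalesce_def] right
      by eventually_elim simp
    then show ?thesis
      unfolding eventually_at_top_linorder by (meson linear order_trans)
  qed
  have path1: "cocycle_path c x (level x + 1) = next_site c x" for c
    by (simp add: cocycle_path_def)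
  have path0: "cocycle_path c (x + e1) (level x + 1) = x + e1"
    "cocycle_path c (x + e2) (level x + 1) = x + e2" for c
    by (simp_all add: cocycle_path_def level_def e1_def e2_def)
  have level: "level (x + e1) = level x + 1" "level (x + e2) = level x + 1"
    by (simp_all add: level_def e1_def e2_def)
  obtain m where "m \<ge> level x + 1"
    "fst (cocycle_path b' (x + e1) m) \<le> fst (cocycle_path b x m)"
    using right_all by blast
  moreover have "fst (cocycle_path b x (level x + 1)) \<le> fst (cocycle_path b' (x + e1) (level x + 1))"
    unfolding path1 path0 by (auto simp: next_site_def e1_def e2_def)
  ultimately obtain i where "cocycle_path b x i = cocycle_path b' (x + e1) i"
    using paths_meet[of x "level x + 1" "x + e1" m b b'] level by auto
  then show "b x (x + e1) \<le> b' x (x + e1)"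
    by (rule le_if_paths_meet[OF assms(1-4)])
  obtain m where "m \<ge> level x + 1"
    "fst (cocycle_path b' x m) \<le> fst (cocycle_path b (x + e2) m)"
    using right_all by blast
  moreover have "fst (cocycle_path b (x + e2) (level x + 1)) \<le> fst (cocycle_path b' x (level x + 1))"
    unfolding path1 path0 by (auto simp: next_site_def e1_def e2_def)
  ultimately obtain i where "cocycle_path b (x + e2) i = cocycle_path b' x i"
    using paths_meet[of "x + e2" "level x + 1" x m b b'] level by auto
  then show "b' x (x + e2) \<le> b x (x + e2)"
    by (intro le_if_paths_meet[OF assms(2,1,4,3)]) (rule sym)
qed

theorem coalescing_cocycles_comparable:
  assumes "cocycle b" "cocycle b'" "recovers b \<omega>" "recovers b' \<omega>"
    and coal: "\<And>u v. coalesce (cocycle_path b u) (cocycle_path b v)"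
      "\<And>u v. coalesce (cocycle_path b' u) (cocycle_path b' v)"
  shows "cocycle_le b b' \<or> cocycle_le b' b"
proof (cases "\<exists>\<^sub>F i in at_top. cocycle_path b 0 i = cocycle_path b' 0 i")
  case True
  then have "b = b'"
    by (rule cocycles_eq_if_paths_meet_frequently[OF assms])
  then show ?thesis by (simp add: cocycle_le_def)
next
  case False
  then obtain M where M: "\<And>i. i \<ge> M \<Longrightarrow> cocycle_path b 0 i \<noteq> cocycle_path b' 0 i"
    by (auto simp: not_frequently eventually_at_top_linorder)
  \<comment> \<open>The paths from the origin live on the levels from 0 on.\<close>
  define k where "k = max M 0"
  have k: "level 0 \<le> k" "M \<le> k"
    by (auto simp: k_def level_def)
  show ?thesis
  proof (cases "fst (cocycle_path b 0 k) \<le> fst (cocycle_path b' 0 k)")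
    case True
    have "fst (cocycle_path b 0 i) \<le> fst (cocycle_path b' 0 i)" if "i \<ge> k" for i
    proof (rule ccontr)
      assume "\<not> ?thesis"
      then have "fst (cocycle_path b' 0 i) \<le> fst (cocycle_path b 0 i)"
        by simp
      from paths_meet[OF k(1) k(1) that True this] obtain j
        where "k \<le> j" "cocycle_path b 0 j = cocycle_path b' 0 j"
        by blast
      then show False using M k(2) by (metis order_trans)
    qed
    then have "cocycle_le b b'"
      by (intro cocycle_le_if_path_eventually_right[OF assms(2,1,4,3) coal(2,1)])
        (auto simp: eventually_at_top_linorder)
    then show ?thesis ..
  next
    case False
    have "fst (cocycle_path b' 0 i) \<le> fst (cocycle_path b 0 i)" if "i \<ge> k" for i
    proof (rule ccontr)
      assume "\<not> ?thesis"
      then have "fst (cocycle_path b 0 i) \<le> fst (cocycle_path b' 0 i)"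
        by simp
      from paths_meet[OF k(1) k(1) that _ this] False obtain j
        where "k \<le> j" "cocycle_path b' 0 j = cocycle_path b 0 j"
        by fastforce
      then show False using M k(2) by (metis order_trans)
    qed
    then have "cocycle_le b' b"
      by (intro cocycle_le_if_path_eventually_right[OF assms])
        (auto simp: eventually_at_top_linorder)
    then show ?thesis ..
  qed
qed

text \<open>The paths depend on the nearest-neighbour increments only, so this is another instance of
  frequent meetings.\<close>

lemma cocycles_eq_if_increments_eq:
  assumes "cocycle b" "cocycle b'" "recovers b \<omega>" "recovers b' \<omega>"
    and coal: "\<And>u v. coalesce (cocycle_path b u) (cocycle_path b v)"
    and eq: "\<And>x. b x (x + e1) = b' x (x + e1)" "\<And>x. b x (x + e2) = b' x (x + e2)"
  shows "b = b'"
proof -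
  have "next_site b = next_site b'"
    by (rule ext) (simp add: next_site_def eq)
  then have path: "cocycle_path b = cocycle_path b'"
    by (intro ext) (simp add: cocycle_path_def)
  show ?thesis
    using coal path by (intro cocycles_eq_if_paths_meet_frequently[OF assms(1-4)]) auto
qed

section \<open>Shift-covariant cocycles of i.i.d. weights\<close>

lemma integrable_cocycle:
  assumes "B \<in> coalescing_cocycles P"
  shows "integrable P (\<lambda>\<omega>. B \<omega> x y)"
  using assms unfolding coalescing_cocycles_def cocycles_def by blast

lemma measurable_cocycle:
  assumes "B \<in> coalescing_cocycles P"
  shows "(\<lambda>\<omega>. B \<omega> x y) \<in> borel_measurable P"
  by (rule borel_measurable_integrable) (rule integrable_cocycle[OF assms])

lemma AE_coalescing_cocycle:
  assumes "B \<in> coalescing_cocycles P"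
  shows "AE \<omega> in P. cocycle (B \<omega>) \<and> recovers (B \<omega>) \<omega> \<and>
    (\<forall>u v. coalesce (cocycle_path (B \<omega>) u) (cocycle_path (B \<omega>) v)) \<and>
    (\<forall>x y z. B \<omega> (x + z) (y + z) = B (shift z \<omega>) x y)"
proof -
  have "AE \<omega> in P. cocycle (B \<omega>) \<and> recovers (B \<omega>) \<omega>"
    "AE \<omega> in P. \<forall>u v. coalesce (cocycle_path (B \<omega>) u) (cocycle_path (B \<omega>) v)"
    "AE \<omega> in P. \<forall>x y z. B \<omega> (x + z) (y + z) = B (shift z \<omega>) x y"
    using assms unfolding coalescing_cocycles_def cocycles_def by blast+
  then show ?thesis
    by eventually_elim blast
qed

lemma shift_preserves_iid_measure:
  assumes "prob_space \<nu>"
  shows "shift z \<in> iid_measure \<nu> \<rightarrow>\<^sub>M iid_measure \<nu>"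
    and "distr (iid_measure \<nu>) (iid_measure \<nu>) (shift z) = iid_measure \<nu>"
proof -
  have shift: "shift z = (\<lambda>\<omega>. \<omega> \<circ> (\<lambda>x. x + z))"
    by (simp add: shift_def fun_eq_iff)
  show "shift z \<in> iid_measure \<nu> \<rightarrow>\<^sub>M iid_measure \<nu>"
    unfolding shift iid_measure_def by (rule measurable_PiM_comp)
  show "distr (iid_measure \<nu>) (iid_measure \<nu>) (shift z) = iid_measure \<nu>"
    unfolding shift iid_measure_def by (rule distr_PiM_comp[OF assms]) (rule injI, simp)
qed

text \<open>Ergodicity: shifting along the first axis alone already moves every site out of every finite
  window.\<close>

lemma iid_measure_ergodic:
  assumes \<nu>: "prob_space \<nu>" and A: "A \<in> sets (iid_measure \<nu>)"
    and inv: "\<And>z. AE \<omega> in iid_measure \<nu>. shift z \<omega> \<in> A \<longleftrightarrow> \<omega> \<in> A"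
  shows "measure (iid_measure \<nu>) A = 0 \<or> measure (iid_measure \<nu>) A = 1"
  unfolding iid_measure_def
proof (rule zero_one_law_reindex[OF \<nu>, of "\<lambda>n x. x + (int n, 0)"])
  show "inj (\<lambda>x :: site. x + (int n, 0))" for n
    by (rule injI) (rule add_right_imp_eq)
  show "\<forall>\<^sub>F n in sequentially. i + (int n, 0) \<noteq> j" for i j
    using eventually_gt_at_top[of "nat (fst j - fst i)"]
    by eventually_elim (auto simp: prod_eq_iff)
  show "A \<in> sets (PiM UNIV (\<lambda>_. \<nu>))"
    using A by (simp add: iid_measure_def)
  show "AE \<omega> in PiM UNIV (\<lambda>_. \<nu>). \<omega> \<circ> (\<lambda>x. x + (int n, 0)) \<in> A \<longleftrightarrow> \<omega> \<in> A" for n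
    using inv[of "(int n, 0)"] unfolding iid_measure_def shift_def comp_def .
qed

lemma shift_cocycle_le_iff:
  "cocycle_le (\<lambda>x y. b (x + z) (y + z)) (\<lambda>x y. b' (x + z) (y + z)) \<longleftrightarrow> cocycle_le b b'"
  (is "?L \<longleftrightarrow> ?R")
proof
  assume L: ?L
  show ?R
    unfolding cocycle_le_def
  proof
    fix x
    have "x - z + e1 + z = x + e1" "x - z + e2 + z = x + e2"
      by simp_all
    then show "b' x (x + e1) \<le> b x (x + e1) \<and> b x (x + e2) \<le> b' x (x + e2)"
      using L[unfolded cocycle_le_def, rule_format, of "x - z"] by simp
  qed
next
  assume R: ?R
  have "x + e1 + z = x + z + e1" "x + e2 + z = x + z + e2" for x
    by (simp_all add: ac_simps)
  then show ?L
    using R unfolding cocycle_le_def by metis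
qed

lemma shift_eq_iff:
  fixes b b' :: "site \<Rightarrow> site \<Rightarrow> real"
  shows "(\<lambda>x y. b (x + z) (y + z)) = (\<lambda>x y. b' (x + z) (y + z)) \<longleftrightarrow> b = b'"
proof
  assume eq: "(\<lambda>x y. b (x + z) (y + z)) = (\<lambda>x y. b' (x + z) (y + z))"
  show "b = b'"
  proof (intro ext)
    fix x y
    show "b x y = b' x y"
      using fun_cong[OF fun_cong[OF eq, of "x - z"], of "y - z"] by simp
  qed
qed simp

lemma sets_cocycle_le:
  assumes "B \<in> coalescing_cocycles P" "B' \<in> coalescing_cocycles P"
  shows "{\<omega> \<in> space P. cocycle_le (B \<omega>) (B' \<omega>)} \<in> sets P"
  unfolding cocycle_le_def
  by (intro sets.sets_Collect_countable_All sets.sets_Collect_conj borel_measurable_le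
      assms[THEN measurable_cocycle])

lemma sets_cocycle_eq:
  assumes "B \<in> coalescing_cocycles P" "B' \<in> coalescing_cocycles P"
  shows "{\<omega> \<in> space P. B \<omega> = B' \<omega>} \<in> sets P"
  unfolding fun_eq_iff
  by (intro sets.sets_Collect_countable_All borel_measurable_eq assms[THEN measurable_cocycle])

lemma AE_shift_covariant_pair:
  assumes "B \<in> coalescing_cocycles P" "B' \<in> coalescing_cocycles P"
  shows "AE \<omega> in P. B (shift z \<omega>) = (\<lambda>x y. B \<omega> (x + z) (y + z)) \<and>
    B' (shift z \<omega>) = (\<lambda>x y. B' \<omega> (x + z) (y + z))"
  using assms[THEN AE_coalescing_cocycle] by eventually_elim (intro conjI ext; metis)

lemma space_iid_measure:
  assumes "sets \<nu> = sets borel"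
  shows "space (iid_measure \<nu>) = UNIV"
  using sets_eq_imp_space_eq[OF sets_iid_measure[OF assms]] by simp

lemma cocycle_le_zero_one:
  assumes "prob_space \<nu>" "sets \<nu> = sets borel" "P = iid_measure \<nu>"
    and B: "B \<in> coalescing_cocycles P" "B' \<in> coalescing_cocycles P"
  shows "\<P>(\<omega> in P. cocycle_le (B \<omega>) (B' \<omega>)) = 0 \<or> \<P>(\<omega> in P. cocycle_le (B \<omega>) (B' \<omega>)) = 1"
  unfolding assms(3)
proof (rule iid_measure_ergodic[OF assms(1)])
  show "AE \<omega> in iid_measure \<nu>.
    shift z \<omega> \<in> {\<omega> \<in> space (iid_measure \<nu>). cocycle_le (B \<omega>) (B' \<omega>)} \<longleftrightarrow>
    \<omega> \<in> {\<omega> \<in> space (iid_measure \<nu>). cocycle_le (B \<omega>) (B' \<omega>)}" for z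
    using AE_shift_covariant_pair[OF B, of z] unfolding assms(3)
    by eventually_elim (simp add: shift_cocycle_le_iff space_iid_measure[OF assms(2)])
qed (use sets_cocycle_le[OF B] assms(3) in simp)

lemma cocycle_eq_zero_one:
  assumes "prob_space \<nu>" "sets \<nu> = sets borel" "P = iid_measure \<nu>"
    and B: "B \<in> coalescing_cocycles P" "B' \<in> coalescing_cocycles P"
  shows "\<P>(\<omega> in P. B \<omega> = B' \<omega>) = 0 \<or> \<P>(\<omega> in P. B \<omega> = B' \<omega>) = 1"
  unfolding assms(3)
proof (rule iid_measure_ergodic[OF assms(1)])
  show "AE \<omega> in iid_measure \<nu>. shift z \<omega> \<in> {\<omega> \<in> space (iid_measure \<nu>). B \<omega> = B' \<omega>} \<longleftrightarrow>
    \<omega> \<in> {\<omega> \<in> space (iid_measure \<nu>). B \<omega> = B' \<omega>}" for z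
    using AE_shift_covariant_pair[OF B, of z] unfolding assms(3)
    by eventually_elim (simp add: shift_eq_iff space_iid_measure[OF assms(2)])
qed (use sets_cocycle_eq[OF B] assms(3) in simp)

lemma vec_le_h_vec_if_AE_cocycle_le:
  assumes "B \<in> coalescing_cocycles P" "B' \<in> coalescing_cocycles P"
    and "AE \<omega> in P. cocycle_le (B \<omega>) (B' \<omega>)"
  shows "vec_le (h_vec P B) (h_vec P B')"
proof -
  have "AE \<omega> in P. B' \<omega> 0 e1 \<le> B \<omega> 0 e1" "AE \<omega> in P. B \<omega> 0 e2 \<le> B' \<omega> 0 e2"
    using assms(3) by (eventually_elim, metis cocycle_le_def add_0)+
  then show ?thesis
    using assms(1,2)
    by (auto simp: vec_le_def h_vec_def intro!: integral_mono_AE integrable_cocycle)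
qed

text \<open>Ordered integrable functions with equal integrals agree almost everywhere. This gives equality
  of the increments at the origin, and stationarity carries it to all sites.\<close>

lemma AE_eq_if_AE_le_and_h_vec_eq:
  assumes \<nu>: "prob_space \<nu>" and P: "P = iid_measure \<nu>"
    and B: "B \<in> coalescing_cocycles P" "B' \<in> coalescing_cocycles P"
    and le: "AE \<omega> in P. cocycle_le (B \<omega>) (B' \<omega>)"
    and h: "h_vec P B = h_vec P B'"
  shows "AE \<omega> in P. B \<omega> = B' \<omega>"
proof -
  note integrable = B[THEN integrable_cocycle]
  have "AE \<omega> in P. 0 \<le> B \<omega> 0 e1 - B' \<omega> 0 e1" "AE \<omega> in P. 0 \<le> B' \<omega> 0 e2 - B \<omega> 0 e2"
    using le by (eventually_elim, metis cocycle_le_def add_0 diff_ge_0_iff_ge)+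
  moreover have "(\<integral>\<omega>. B \<omega> 0 e1 - B' \<omega> 0 e1 \<partial>P) = 0" "(\<integral>\<omega>. B' \<omega> 0 e2 - B \<omega> 0 e2 \<partial>P) = 0"
    using h integrable by (simp_all add: h_vec_def)
  ultimately have "AE \<omega> in P. B \<omega> 0 e1 - B' \<omega> 0 e1 = 0" "AE \<omega> in P. B' \<omega> 0 e2 - B \<omega> 0 e2 = 0"
    by (simp_all only: integral_nonneg_eq_0_iff_AE Bochner_Integration.integrable_diff integrable)
  then have origin: "AE \<omega> in P. B \<omega> 0 e1 = B' \<omega> 0 e1 \<and> B \<omega> 0 e2 = B' \<omega> 0 e2"
    by eventually_elim simp
  have "AE \<omega> in P. B (shift z \<omega>) 0 e1 = B' (shift z \<omega>) 0 e1 \<and>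
      B (shift z \<omega>) 0 e2 = B' (shift z \<omega>) 0 e2" for z
    using origin shift_preserves_iid_measure[OF \<nu>, of z]
    by (intro AE_distrD[of "shift z" P P]) (simp_all only: P)
  then have "AE \<omega> in P. \<forall>z. B (shift z \<omega>) 0 e1 = B' (shift z \<omega>) 0 e1 \<and>
      B (shift z \<omega>) 0 e2 = B' (shift z \<omega>) 0 e2"
    by (simp add: AE_all_countable)
  with B[THEN AE_coalescing_cocycle] show ?thesis
  proof eventually_elim
    case (elim \<omega>)
    have "B \<omega> (0 + z) (e1 + z) = B' \<omega> (0 + z) (e1 + z)"
      "B \<omega> (0 + z) (e2 + z) = B' \<omega> (0 + z) (e2 + z)" for z
      using elim by metis+
    then show ?case
      using elim by (intro cocycles_eq_if_increments_eq[of "B \<omega>" "B' \<omega>" \<omega>])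
        (auto simp: add.commute[of _ e1] add.commute[of _ e2])
  qed
qed

lemma strictly_ordered_or_equal:
  assumes \<nu>: "prob_space \<nu>" "sets \<nu> = sets borel" and P: "P = iid_measure \<nu>"
    and B: "B \<in> coalescing_cocycles P" "B' \<in> coalescing_cocycles P"
    and le: "AE \<omega> in P. cocycle_le (B \<omega>) (B' \<omega>)"
  shows "(vec_le (h_vec P B) (h_vec P B') \<and> h_vec P B \<noteq> h_vec P B' \<and>
       \<P>(\<omega> in P. cocycle_le (B \<omega>) (B' \<omega>) \<and> B \<omega> \<noteq> B' \<omega>) = 1) \<or>
    (h_vec P B = h_vec P B' \<and> \<P>(\<omega> in P. B \<omega> = B' \<omega>) = 1)"
proof -
  interpret prob_space P
    unfolding P iid_measure_def by (rule prob_space_PiM) (rule \<nu>(1))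
  note meas = sets_cocycle_eq[OF B] sets_cocycle_le[OF B]
  show ?thesis
  proof (cases "h_vec P B = h_vec P B'")
    case True
    then show ?thesis
      using AE_eq_if_AE_le_and_h_vec_eq[OF \<nu>(1) P B le] meas by (simp add: prob_Collect_eq_1)
  next
    case False
    have "\<not> (AE \<omega> in P. B \<omega> = B' \<omega>)"
    proof
      assume "AE \<omega> in P. B \<omega> = B' \<omega>"
      then have "AE \<omega> in P. B \<omega> x y = B' \<omega> x y" for x y
        by eventually_elim simp
      then have "(\<integral>\<omega>. B \<omega> x y \<partial>P) = (\<integral>\<omega>. B' \<omega> x y \<partial>P)" for x y
        by (intro integral_cong_AE B[THEN measurable_cocycle])
      then show False using False by (simp add: h_vec_def)
    qed
    then have "\<P>(\<omega> in P. B \<omega> = B' \<omega>) = 0"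
      using cocycle_eq_zero_one[OF \<nu> P B] meas by (simp add: prob_Collect_eq_1)
    then have "AE \<omega> in P. B \<omega> \<noteq> B' \<omega>"
      using meas by (simp add: prob_Collect_eq_0)
    with le have "AE \<omega> in P. cocycle_le (B \<omega>) (B' \<omega>) \<and> B \<omega> \<noteq> B' \<omega>"
      by eventually_elim simp
    moreover have "{\<omega> \<in> space P. cocycle_le (B \<omega>) (B' \<omega>) \<and> B \<omega> \<noteq> B' \<omega>} \<in> events"
      using meas by measurable
    ultimately show ?thesis
      using False vec_le_h_vec_if_AE_cocycle_le[OF B le] by (simp add: prob_Collect_eq_1)
  qed
qed

theorem theorem3p4:
  fixes \<nu> :: "real measure" and P :: "config measure" and \<epsilon> :: real
    and B1 B2 :: "config \<Rightarrow> site \<Rightarrow> site \<Rightarrow> real"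
  assumes "prob_space \<nu>" and "sets \<nu> = sets borel"
    and "P = iid_measure \<nu>"
    and "\<epsilon> > 0" and "integrable P (\<lambda>\<omega>. \<bar>\<omega> 0\<bar> powr (2 + \<epsilon>))"
    and "(\<integral>\<omega>. (\<omega> 0)\<^sup>2 \<partial>P) > (\<integral>\<omega>. \<omega> 0 \<partial>P)\<^sup>2"
    and "B1 \<in> coalescing_cocycles P" and "B2 \<in> coalescing_cocycles P"
  shows "exactly_one
    (vec_le (h_vec P B1) (h_vec P B2) \<and> h_vec P B1 \<noteq> h_vec P B2 \<and>
       \<P>(\<omega> in P. cocycle_le (B1 \<omega>) (B2 \<omega>) \<and> B1 \<omega> \<noteq> B2 \<omega>) = 1)
    (vec_le (h_vec P B2) (h_vec P B1) \<and> h_vec P B2 \<noteq> h_vec P B1 \<and>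
       \<P>(\<omega> in P. cocycle_le (B2 \<omega>) (B1 \<omega>) \<and> B2 \<omega> \<noteq> B1 \<omega>) = 1)
    (h_vec P B1 = h_vec P B2 \<and> \<P>(\<omega> in P. B1 \<omega> = B2 \<omega>) = 1)"
  (is "exactly_one ?a ?b ?c")
proof -
  note \<nu> = assms(1,2) and P = assms(3) and B = assms(7,8)
  interpret prob_space P
    unfolding P iid_measure_def by (rule prob_space_PiM) (rule \<nu>(1))
  have "AE \<omega> in P. cocycle_le (B1 \<omega>) (B2 \<omega>) \<or> cocycle_le (B2 \<omega>) (B1 \<omega>)"
    using B[THEN AE_coalescing_cocycle]
    by eventually_elim (rule coalescing_cocycles_comparable, auto)
  then have "\<not> (\<P>(\<omega> in P. cocycle_le (B1 \<omega>) (B2 \<omega>)) = 0 \<and> \<P>(\<omega> in P. cocycle_le (B2 \<omega>) (B1 \<omega>)) = 0)"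
  proof (intro notI, elim conjE)
    assume "\<P>(\<omega> in P. cocycle_le (B1 \<omega>) (B2 \<omega>)) = 0" "\<P>(\<omega> in P. cocycle_le (B2 \<omega>) (B1 \<omega>)) = 0"
    then have "AE \<omega> in P. \<not> cocycle_le (B1 \<omega>) (B2 \<omega>)" "AE \<omega> in P. \<not> cocycle_le (B2 \<omega>) (B1 \<omega>)"
      using sets_cocycle_le[OF B] sets_cocycle_le[OF B(2,1)] by (simp_all add: prob_Collect_eq_0)
    with \<open>AE \<omega> in P. cocycle_le (B1 \<omega>) (B2 \<omega>) \<or> cocycle_le (B2 \<omega>) (B1 \<omega>)\<close> have "AE \<omega> in P. False"
      by eventually_elim simp
    then show False by simp
  qed
  then have "(AE \<omega> in P. cocycle_le (B1 \<omega>) (B2 \<omega>)) \<or> (AE \<omega> in P. cocycle_le (B2 \<omega>) (B1 \<omega>))"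
    using cocycle_le_zero_one[OF \<nu> P B] cocycle_le_zero_one[OF \<nu> P B(2,1)]
      sets_cocycle_le[OF B] sets_cocycle_le[OF B(2,1)] by (auto simp: prob_Collect_eq_1)
  then have cover: "?a \<or> ?b \<or> ?c"
  proof
    assume "AE \<omega> in P. cocycle_le (B1 \<omega>) (B2 \<omega>)"
    then show ?thesis
      using strictly_ordered_or_equal[OF \<nu> P B] by blast
  next
    assume "AE \<omega> in P. cocycle_le (B2 \<omega>) (B1 \<omega>)"
    then have "?b \<or> (h_vec P B2 = h_vec P B1 \<and> \<P>(\<omega> in P. B2 \<omega> = B1 \<omega>) = 1)"
      using strictly_ordered_or_equal[OF \<nu> P B(2,1)] by blast
    moreover have "{\<omega> \<in> space P. B2 \<omega> = B1 \<omega>} = {\<omega> \<in> space P. B1 \<omega> = B2 \<omega>}"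
      by (metis (no_types))
    ultimately show ?thesis
      by (elim disjE) (blast, simp)
  qed
  have "h_vec P B1 = h_vec P B2"
    if "vec_le (h_vec P B1) (h_vec P B2)" "vec_le (h_vec P B2) (h_vec P B1)"
    using that by (simp add: vec_le_def prod_eq_iff)
  with cover show ?thesis
    unfolding exactly_one_def by (intro conjI; (assumption | force))
qed

end
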